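(* Let $n\ge 1$ and the observations $y_1,\dots,y_n$ be fixed. Assume: (X1) the artificial data-points $(X_j)_{j\ge1}$ are realisations of a $\mathbb{P}_\psi$-ergodic process; (C1) the random sequence $(\hat\xi^{\mathrm{NCE}}_{n,m})_{m\ge1}$ is an approximate NCE estimator, i.e. $\ell^{\mathrm{NCE}}_{n,m}(\hat\xi^{\mathrm{NCE}}_{n,m})\ge \sup_{\xi\in\Xi}\ell^{\mathrm{NCE}}_{n,m}(\xi)-o(1)$ almost surely (with $o(1)\to0$ as $m\to\infty$), and it belongs to a compact set almost surely; (H1) the maps $\theta\mapsto h_\theta(x)$ are (1) lower semi-continuous at each $\theta\in\Theta$, except for $x$ in a $\mathbb{P}_\psi$-null set that may depend on $\theta$; and (2) upper semi-continuous, for any $x$ not in a $\mathbb{P}_\psi$-null set (that does not depend on $\theta$), and for all $x=y_i$, $i=1,\dots,n$. Then, almost surely, $\hat\xi^{\mathrm{NCE}}_{n,m}\to\hat\xi_n$ as $m\to\infty$.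
   Context: Setting. $\Theta$ is an open subset of $\mathbb{R}^d$, $\mathcal{X}\subset\mathbb{R}^k$, $\mu$ is a measure on $\mathcal{X}$, and for each $\theta\in\Theta$, $h_\theta\ge0$ is a measurable function on $\mathcal{X}$ with $\mathcal{Z}(\theta)=\int_{\mathcal{X}}h_\theta(x)\,\mu(\mathrm{d}x)\in(0,\infty)$. $\mathbb{P}_\theta$ is the probability with density $f_\theta=h_\theta/\mathcal{Z}(\theta)$ with respect to $\mu$; the model is identifiable ($\theta\mapsto\mathbb{P}_\theta$ is injective). $\mathbb{P}_\psi$ is a probability with density $f_\psi=h_\psi/\mathcal{Z}(\psi)$ with respect to $\mu$ (where $h_\psi\geq 0$ and $\mathcal{Z}(\psi)=\int h_\psi\,\mathrm{d}\mu\in(0,\infty)$); it need not belong to the model, but $\mathbb{P}_\theta\ll\mathbb{P}_\psi$ for every $\theta\in\Theta$. $\mathbb{E}_\psi$ denotes expectation under $X\sim\mathbb{P}_\psi$. The points $y_1,\dots,y_n\in\mathcal{X}$ satisfy $h_\psi(y_i)>0$. A process $(X_j)_{j\ge1}$ is $\mathbb{P}_\psi$-ergodic if $\frac1m\sum_{j=1}^m\varphi(X_j)\to\mathbb{E}_\psi[\varphi(X)]$ almost surely as $m\to\infty$ for every measurable real-valued $\varphi$ with $\mathbb{E}_\psi|\varphi(X)|<\infty$. Write $\xi=(\theta,\nu)\in\Xi=\Theta\times\mathbb{R}$. The NCE objective is $$\ell^{\mathrm{NCE}}_{n,m}(\theta,\nu)=\sum_{i=1}^n\log q_{\theta,\nu}(y_i)+\sum_{j=1}^m\log\{1-q_{\theta,\nu}(X_j)\},\qquad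 \log\frac{q_{\theta,\nu}(x)}{1-q_{\theta,\nu}(x)}=\log\frac{h_\theta(x)}{h_\psi(x)}+\nu+\log\frac nm .$$ The (extended) log-likelihood is $$\ell_n(\theta,\nu)=\frac1n\sum_{i=1}^n\log\frac{h_\theta(y_i)}{h_\psi(y_i)}+\nu-e^{\nu}\frac{\mathcal{Z}(\theta)}{\mathcal{Z}(\psi)} .$$ It is assumed that the MLE exists and is unique, i.e. that $\ell_n(\theta,\nu)$ has a unique maximiser $\hat\xi_n=(\hat\theta_n,\hat\nu_n)$ over $\Xi$; equivalently $\hat\theta_n$ is the unique maximiser of $\ell_n(\theta)=\frac1n\sum_{i=1}^n\log h_\theta(y_i)-\log\mathcal{Z}(\theta)$, and $\hat\nu_n=\log\{\mathcal{Z}(\psi)/\mathcal{Z}(\hat\theta_n)\}$. Convention: $\log 0=-\infty$. *)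

theory Defs
  imports "HOL-Probability.Probability"
begin

section \<open>Unnormalised models\<close>

definition unnormalised_density :: "'x measure \<Rightarrow> ('x \<Rightarrow> real) \<Rightarrow> bool" where
  "unnormalised_density \<mu> g \<longleftrightarrow>
     g \<in> borel_measurable \<mu> \<and> (\<forall>x\<in>space \<mu>. 0 \<le> g x) \<and>
     integrable \<mu> g \<and> 0 < (\<integral>x. g x \<partial>\<mu>)"

definition partition_fun :: "'x measure \<Rightarrow> ('x \<Rightarrow> real) \<Rightarrow> real" where
  "partition_fun \<mu> g = (\<integral>x. g x \<partial>\<mu>)"

definition normalised_measure :: "'x measure \<Rightarrow> ('x \<Rightarrow> real) \<Rightarrow> 'x measure" where
  "normalised_measure \<mu> g = density \<mu> (\<lambda>x. ennreal (g x / partition_fun \<mu> g))"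

section \<open>Semi-continuity at a point, relative to a set\<close>

definition lower_semicont_within :: "('a::topological_space \<Rightarrow> real) \<Rightarrow> 'a \<Rightarrow> 'a set \<Rightarrow> bool" where
  "lower_semicont_within f t S \<longleftrightarrow> (\<forall>c < f t. \<forall>\<^sub>F s in at t within S. c < f s)"

definition upper_semicont_within :: "('a::topological_space \<Rightarrow> real) \<Rightarrow> 'a \<Rightarrow> 'a set \<Rightarrow> bool" where
  "upper_semicont_within f t S \<longleftrightarrow> (\<forall>c > f t. \<forall>\<^sub>F s in at t within S. f s < c)"

section \<open>Ergodic processes\<close>

text \<open>Only the variables with index \<open>j \<ge> 1\<close> matter. Integrability is with respect to \<open>P\<close>, and
  the exceptional event may depend on \<open>\<phi>\<close>.\<close>

definition ergodic_process :: "'w measure \<Rightarrow> 'x measure \<Rightarrow> (nat \<Rightarrow> 'w \<Rightarrow> 'x) \<Rightarrow> bool" where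
  "ergodic_process M P X \<longleftrightarrow>
     (\<forall>j\<ge>1. X j \<in> measurable M P) \<and>
     (\<forall>\<phi>::'x \<Rightarrow> real. integrable P \<phi> \<longrightarrow>
        (AE \<omega> in M. (\<lambda>m. (1 / real m) * (\<Sum>j=1..m. \<phi> (X j \<omega>))) \<longlonglongrightarrow> (\<integral>x. \<phi> x \<partial>P)))"

section \<open>Objective functions\<close>

text \<open>Logarithm of a non-negative real, with \<open>log 0 = -\<infinity>\<close>.\<close>

definition elog :: "real \<Rightarrow> ereal" where
  "elog x = (if 0 < x then ereal (ln x) else - \<infinity>)"

text \<open>\<open>nce_prob n m f g \<nu> x\<close> is the probability with the prescribed log-odds, for \<open>f = h\<^sub>\<theta>\<close>
  and \<open>g = h\<^sub>\<psi>\<close>. The value 1 has to be excluded by hand because \<open>1 / 0 = 0\<close>. At points where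
  \<open>g x = 0\<close> (a null set for the probability with unnormalised density \<open>g\<close>), where the log-odds
  are not meaningful, the quotient is 0 and hence so is the probability.\<close>

definition nce_prob :: "nat \<Rightarrow> nat \<Rightarrow> ('x \<Rightarrow> real) \<Rightarrow> ('x \<Rightarrow> real) \<Rightarrow> real \<Rightarrow> 'x \<Rightarrow> real" where
  "nce_prob n m f g \<nu> x =
     (THE q. 0 \<le> q \<and> q < 1 \<and>
        elog (q / (1 - q)) = elog (f x / g x) + ereal \<nu> + ereal (ln (real n / real m)))"

definition nce_objective ::
  "nat \<Rightarrow> nat \<Rightarrow> (nat \<Rightarrow> 'x) \<Rightarrow> (nat \<Rightarrow> 'x) \<Rightarrow> ('t \<Rightarrow> 'x \<Rightarrow> real) \<Rightarrow> ('x \<Rightarrow> real) \<Rightarrow> 't \<times> real \<Rightarrow> ereal"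
  where
  "nce_objective n m y x h g = (\<lambda>(\<theta>, \<nu>).
     (\<Sum>i=1..n. elog (nce_prob n m (h \<theta>) g \<nu> (y i))) +
     (\<Sum>j=1..m. elog (1 - nce_prob n m (h \<theta>) g \<nu> (x j))))"

definition ext_log_lik ::
  "nat \<Rightarrow> (nat \<Rightarrow> 'x) \<Rightarrow> 'x measure \<Rightarrow> ('t \<Rightarrow> 'x \<Rightarrow> real) \<Rightarrow> ('x \<Rightarrow> real) \<Rightarrow> 't \<times> real \<Rightarrow> ereal"
  where
  "ext_log_lik n y \<mu> h g = (\<lambda>(\<theta>, \<nu>).
     ereal (1 / real n) * (\<Sum>i=1..n. elog (h \<theta> (y i) / g (y i))) + ereal \<nu>
     - ereal (exp \<nu> * (partition_fun \<mu> (h \<theta>) / partition_fun \<mu> g)))"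

definition unique_maximiser :: "('a \<Rightarrow> ereal) \<Rightarrow> 'a set \<Rightarrow> 'a \<Rightarrow> bool" where
  "unique_maximiser L S a \<longleftrightarrow>
     is_arg_max L (\<lambda>s. s \<in> S) a \<and> (\<forall>b. is_arg_max L (\<lambda>s. s \<in> S) b \<longrightarrow> b = a)"

lemma nce_prob_eq:
  fixes f g :: "'x \<Rightarrow> real" and \<nu> :: real
  assumes "0 \<le> f x" "0 \<le> g x" "0 < n" "0 < m"
  defines "r \<equiv> f x / g x * exp \<nu> * (real n / real m)"
  shows "nce_prob n m f g \<nu> x = r / (1 + r)"
proof -
  have r0: "r \<ge> 0" using assms by simp
  have inj: "a = b" if "elog a = elog b" "0 \<le> a" "0 \<le> b" for a b
    using that by (auto simp: elog_def split: if_splits)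
  have el: "elog (f x / g x) + ereal \<nu> + ereal (ln (real n / real m)) = elog r"
  proof (cases "f x / g x = 0")
    case True
    then show ?thesis by (auto simp: elog_def r_def)
  next
    case False
    then have "0 < f x / g x" using assms(1,2) by (simp add: less_le)
    moreover from this have "f x \<noteq> 0" "g x \<noteq> 0" by auto
    ultimately show ?thesis using assms(3,4)
      by (simp add: elog_def r_def ln_mult del: times_divide_eq_left times_divide_eq_right)
  qed
  have iff: "(0 \<le> q \<and> q < 1 \<and> elog (q / (1 - q)) = elog r) \<longleftrightarrow> q = r / (1 + r)" for q
  proof
    assume q: "0 \<le> q \<and> q < 1 \<and> elog (q / (1 - q)) = elog r"
    then have "q / (1 - q) = r" using inj r0 by simp
    then show "q = r / (1 + r)" using q r0 by (auto simp: field_simps)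
  next
    assume q: "q = r / (1 + r)"
    have "1 - q = 1 / (1 + r)" using r0 by (simp add: q field_simps)
    then have "q / (1 - q) = r" using r0 by (simp add: q)
    moreover have "0 \<le> q" "q < 1" using r0 by (simp_all add: q)
    ultimately show "0 \<le> q \<and> q < 1 \<and> elog (q / (1 - q)) = elog r" by simp
  qed
  show ?thesis unfolding nce_prob_def el iff by simp
qed

end

theory Submission
  imports Defs "HOL-Real_Asymp.Real_Asymp"
begin

text \<open>
  This is a Wald-type consistency argument, carried out on likelihoods instead of log-likelihoods so
  that the value \<open>- \<infinity>\<close> becomes the harmless real number 0.

  Put \<open>w\<^sub>\<xi> = e\<^sup>\<nu> h\<^sub>\<theta> / h\<^sub>\<psi>\<close>. Up to the factor \<open>(n/m)\<^sup>n\<close>, which is free of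
  \<open>\<xi>\<close>, the exponential of the NCE objective is
  \<open>\<Prod>\<^sub>i w\<^sub>\<xi>(y\<^sub>i) / (1 + (n/m) w\<^sub>\<xi>(y\<^sub>i)) \<cdot> \<Prod>\<^sub>j 1 / (1 + (n/m) w\<^sub>\<xi>(X\<^sub>j))\<close>. As \<open>m \<rightarrow> \<infinity>\<close>,
  the denominators in the first product tend to 1, and since \<open>ln (1 + u) \<approx> u\<close> for small \<open>u\<close>, the
  second product behaves like \<open>exp (- n \<cdot> (1/m) \<Sum>\<^sub>j w\<^sub>\<xi>(X\<^sub>j))\<close>, which ergodicity sends to
  \<open>exp (- n E\<^sub>\<psi> w\<^sub>\<xi>)\<close>. The limit \<open>G(\<xi>) = \<Prod>\<^sub>i w\<^sub>\<xi>(y\<^sub>i) \<cdot> exp (- n E\<^sub>\<psi> w\<^sub>\<xi>)\<close>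
  is the exponential of \<open>n\<close> times the extended log-likelihood, so the MLE is its strict maximiser.

  Only two one-sided versions of this limit are required. At the MLE, \<open>ln (1 + u) \<le> u\<close> bounds the
  criterion from below by something tending to \<open>G\<close> (\<open>nce_lik_eventually_greater\<close>). Near any
  other \<open>\<xi>\<close>, the criterion is eventually smaller than any constant \<open>c > G(\<xi>)\<close>, uniformly on a
  neighbourhood of \<open>\<xi>\<close> (\<open>nce_lik_less_near\<close>). A near-maximiser therefore leaves
  each of these neighbourhoods; countably many of them cover \<open>\<Xi>\<close> without the MLE, so one
  exceptional event serves for all, and on the (random) compact set finitely many of them suffice
  (\<open>tendsto_of_local_separation\<close>).

  The delicate point is the uniform bound, where \<open>w\<^sub>\<xi>\<close> has to be replaced by an infimum over an
  uncountable neighbourhood. Upper semi-continuity makes this infimum equal to one over a countable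
  dense subset, hence measurable; lower semi-continuity makes its expectation approach
  \<open>E\<^sub>\<psi> w\<^sub>\<xi>\<close> as the neighbourhood shrinks (\<open>ex_bounded_local_minorant\<close>).
\<close>

definition importance_weight ::
  "('t \<Rightarrow> 'x \<Rightarrow> real) \<Rightarrow> ('x \<Rightarrow> real) \<Rightarrow> 't \<times> real \<Rightarrow> 'x \<Rightarrow> real" where
  "importance_weight h g \<xi> x = h (fst \<xi>) x / g x * exp (snd \<xi>)"

text \<open>The exponential of the NCE objective without the factor \<open>(n/m)\<^sup>n\<close>, as a function of the
  weight \<open>w = w\<^sub>\<xi>\<close>. That factor alone drives the objective to \<open>- \<infinity>\<close>; without it there is a finite
  limit as \<open>m \<rightarrow> \<infinity>\<close>.\<close>

definition nce_lik :: "nat \<Rightarrow> nat \<Rightarrow> (nat \<Rightarrow> 'x) \<Rightarrow> (nat \<Rightarrow> 'x) \<Rightarrow> ('x \<Rightarrow> real) \<Rightarrow> real" where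
  "nce_lik n m y x w =
     (\<Prod>i=1..n. w (y i) / (1 + real n / real m * w (y i))) *
     (\<Prod>j=1..m. 1 / (1 + real n / real m * w (x j)))"

text \<open>Up to constants, this is the likelihood of observing the points \<open>y\<^sub>i\<close> from a Poisson process
  with intensity \<open>n w\<close> relative to \<open>P\<close>.\<close>

definition poisson_lik :: "nat \<Rightarrow> (nat \<Rightarrow> 'x) \<Rightarrow> 'x measure \<Rightarrow> ('x \<Rightarrow> real) \<Rightarrow> real" where
  "poisson_lik n y P w = (\<Prod>i=1..n. w (y i)) * exp (- (real n * (\<integral>x. w x \<partial>P)))"

section \<open>Objectives as logarithms of likelihoods\<close>

lemma elog_le_iff: "0 \<le> a \<Longrightarrow> 0 \<le> b \<Longrightarrow> elog a \<le> elog b \<longleftrightarrow> a \<le> b"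
  by (auto simp: elog_def)

lemma elog_mult_exp: "elog (a * exp c) = elog a + ereal c"
  by (auto simp: elog_def ln_mult zero_less_mult_iff)

lemma elog_mult: "0 \<le> a \<Longrightarrow> 0 \<le> b \<Longrightarrow> elog (a * b) = elog a + elog b"
  by (auto simp: elog_def ln_mult zero_less_mult_iff)

lemma sum_elog:
  assumes "finite I" "\<And>i. i \<in> I \<Longrightarrow> 0 \<le> f i"
  shows "(\<Sum>i\<in>I. elog (f i)) = elog (\<Prod>i\<in>I. f i)"
  using assms
proof (induction I rule: finite_induct)
  case empty
  then show ?case by (simp add: elog_def zero_ereal_def)
next
  case (insert i I)
  then show ?case by (simp add: elog_mult prod_nonneg)
qed

lemma nce_lik_nonneg:
  assumes "\<And>i. i \<in> {1..n} \<Longrightarrow> 0 \<le> w (y i)" "\<And>j. j \<in> {1..m} \<Longrightarrow> 0 \<le> w (x j)"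
  shows "0 \<le> nce_lik n m y x w"
  unfolding nce_lik_def using assms by (intro mult_nonneg_nonneg prod_nonneg) auto

lemma nce_objective_eq_elog_nce_lik:
  assumes "0 < n" "0 < m"
    and y: "\<And>i. i \<in> {1..n} \<Longrightarrow> 0 \<le> h (fst \<xi>) (y i) \<and> 0 \<le> g (y i)"
    and x: "\<And>j. j \<in> {1..m} \<Longrightarrow> 0 \<le> h (fst \<xi>) (x j) \<and> 0 \<le> g (x j)"
  shows "nce_objective n m y x h g \<xi> =
    elog ((real n / real m) ^ n * nce_lik n m y x (importance_weight h g \<xi>))"
proof -
  obtain \<theta> \<nu> where \<xi>: "\<xi> = (\<theta>, \<nu>)" by fastforce
  define w where "w = importance_weight h g \<xi>"
  define a where "a = real n / real m"
  have a: "0 < a" using assms(1,2) by (simp add: a_def)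
  have wy: "0 \<le> w (y i)" if "i \<in> {1..n}" for i
    using y[OF that] by (simp add: w_def importance_weight_def)
  have wx: "0 \<le> w (x j)" if "j \<in> {1..m}" for j
    using x[OF that] by (simp add: w_def importance_weight_def)
  have q: "nce_prob n m (h \<theta>) g \<nu> z = a * w z / (1 + a * w z)"
    if "0 \<le> h \<theta> z" "0 \<le> g z" for z
    using nce_prob_eq[where f = "h \<theta>" and g = g and \<nu> = \<nu> and x = z and n = n and m = m] that assms(1,2)
    by (simp add: w_def importance_weight_def a_def \<xi> mult_ac)
  have q1: "1 - nce_prob n m (h \<theta>) g \<nu> (x j) = 1 / (1 + a * w (x j))" if "j \<in> {1..m}" for j
  proof -
    have "0 \<le> a * w (x j)" using a wx[OF that] by simp
    then show ?thesis using q x[OF that] by (simp add: \<xi> field_simps)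
  qed
  have nn: "0 \<le> 1 + a * w (y i)" if "i \<in> {1..n}" for i using a wy[OF that] by simp
  have nn': "0 \<le> 1 + a * w (x i)" if "i \<in> {1..m}" for i using a wx[OF that] by simp
  have "nce_objective n m y x h g \<xi> =
      (\<Sum>i=1..n. elog (a * w (y i) / (1 + a * w (y i)))) + (\<Sum>j=1..m. elog (1 / (1 + a * w (x j))))"
    unfolding nce_objective_def \<xi> prod.case
    by (intro arg_cong2[where f = "(+)"] sum.cong refl arg_cong[where f = elog] q q1)
       (use y \<xi> in auto)
  also have "\<dots> = elog (\<Prod>i=1..n. a * w (y i) / (1 + a * w (y i))) + elog (\<Prod>j=1..m. 1 / (1 + a * w (x j)))"
    using nn nn' wy a by (subst (1 2) sum_elog) auto
  also have "\<dots> = elog ((\<Prod>i=1..n. a * w (y i) / (1 + a * w (y i))) * (\<Prod>j=1..m. 1 / (1 + a * w (x j))))"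
    using nn nn' wy a by (intro elog_mult[symmetric] prod_nonneg) auto
  also have "(\<Prod>i=1..n. a * w (y i) / (1 + a * w (y i))) = a ^ n * (\<Prod>i=1..n. w (y i) / (1 + a * w (y i)))"
    by (simp add: prod.distrib prod_dividef)
  finally show ?thesis by (simp add: nce_lik_def w_def a_def mult.assoc)
qed

lemma poisson_lik_nonneg:
  "(\<And>i. i \<in> {1..n} \<Longrightarrow> 0 \<le> w (y i)) \<Longrightarrow> 0 \<le> poisson_lik n y P w"
  unfolding poisson_lik_def by (intro mult_nonneg_nonneg prod_nonneg) auto

lemma ext_log_lik_eq_elog_poisson_lik:
  assumes "0 < n"
    and y: "\<And>i. i \<in> {1..n} \<Longrightarrow> 0 \<le> h (fst \<xi>) (y i) \<and> 0 \<le> g (y i)"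
    and I: "(\<integral>x. importance_weight h g \<xi> x \<partial>P) =
      exp (snd \<xi>) * (partition_fun \<mu> (h (fst \<xi>)) / partition_fun \<mu> g)"
  shows "ext_log_lik n y \<mu> h g \<xi> =
    ereal (1 / real n) * elog (poisson_lik n y P (importance_weight h g \<xi>))"
proof -
  obtain \<theta> \<nu> where \<xi>: "\<xi> = (\<theta>, \<nu>)" by fastforce
  define p where "p = (\<Prod>i=1..n. h \<theta> (y i) / g (y i))"
  define J where "J = exp \<nu> * (partition_fun \<mu> (h \<theta>) / partition_fun \<mu> g)"
  have p: "0 \<le> p" using y by (auto simp: p_def \<xi> intro!: prod_nonneg)
  have "poisson_lik n y P (importance_weight h g \<xi>) = p * exp (real n * \<nu> - real n * J)"
    unfolding poisson_lik_def I
    by (simp add: importance_weight_def \<xi> prod.distrib prod_dividef p_def J_def exp_diff exp_minus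
        field_simps flip: exp_of_nat_mult)
  moreover have "ext_log_lik n y \<mu> h g \<xi> = ereal (1 / real n) * elog p + ereal \<nu> - ereal J"
    unfolding ext_log_lik_def \<xi> prod.case p_def J_def
    by (subst sum_elog) (use y \<xi> in auto)
  ultimately show ?thesis using assms(1) p
    by (auto simp: elog_def ln_mult field_simps zero_less_mult_iff)
qed

lemma unique_maximiser_less:
  assumes "unique_maximiser L S a" "b \<in> S" "b \<noteq> a"
  shows "L b < L a"
proof -
  have a: "a \<in> S" "\<And>c. c \<in> S \<Longrightarrow> L c \<le> L a"
    using assms(1) by (auto simp: unique_maximiser_def is_arg_max_def not_less)
  have "L b \<noteq> L a"
  proof
    assume "L b = L a"
    then have "is_arg_max L (\<lambda>s. s \<in> S) b"
      using a assms(2) by (auto simp: is_arg_max_def not_less)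
    then show False using assms(1,3) by (auto simp: unique_maximiser_def)
  qed
  then show ?thesis using a assms(2) by (simp add: less_le)
qed

section \<open>The weights under the reference distribution\<close>

text \<open>Domination enters here: it forces \<open>h\<^sub>\<theta> = 0\<close> almost everywhere on \<open>{h\<^sub>\<psi> = 0}\<close>, where the
  convention \<open>x / 0 = 0\<close> would otherwise make the weight lose mass.\<close>

lemma importance_weight_integral:
  assumes f: "unnormalised_density \<mu> (h (fst \<xi>))" and g: "unnormalised_density \<mu> g"
    and dom: "absolutely_continuous (normalised_measure \<mu> g) (normalised_measure \<mu> (h (fst \<xi>)))"
  shows "integrable (normalised_measure \<mu> g) (importance_weight h g \<xi>)" (is ?A)
    and "(\<integral>x. importance_weight h g \<xi> x \<partial>normalised_measure \<mu> g) =
      exp (snd \<xi>) * (partition_fun \<mu> (h (fst \<xi>)) / partition_fun \<mu> g)" (is ?B)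
proof -
  let ?f = "h (fst \<xi>)"
  let ?Z = "partition_fun \<mu> g"
  let ?w = "importance_weight h g \<xi>"
  have [measurable]: "?f \<in> borel_measurable \<mu>" "g \<in> borel_measurable \<mu>"
    using f g by (auto simp: unnormalised_density_def)
  have Z: "0 < ?Z" "0 < partition_fun \<mu> ?f"
    using f g by (auto simp: unnormalised_density_def partition_fun_def)
  have nn: "0 \<le> ?f x" "0 \<le> g x" if "x \<in> space \<mu>" for x
    using f g that by (auto simp: unnormalised_density_def)
  have [measurable]: "?w \<in> borel_measurable \<mu>"
    unfolding importance_weight_def[abs_def] by measurable
  define N where "N = {x \<in> space \<mu>. g x = 0}"
  have N: "N \<in> sets \<mu>" unfolding N_def by measurable
  have "N \<in> null_sets (normalised_measure \<mu> g)"
    unfolding normalised_measure_def using N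
    by (subst null_sets_density_iff) (auto simp: N_def)
  then have "N \<in> null_sets (normalised_measure \<mu> ?f)"
    using dom by (auto simp: absolutely_continuous_def)
  then have "AE x in \<mu>. x \<in> N \<longrightarrow> ennreal (?f x / partition_fun \<mu> ?f) = 0"
    unfolding normalised_measure_def by (subst (asm) null_sets_density_iff) auto
  then have ae: "AE x in \<mu>. (g x / ?Z) *\<^sub>R ?w x = (exp (snd \<xi>) / ?Z) * ?f x"
  proof (rule AE_mp, intro AE_I2 impI)
    fix x assume x: "x \<in> space \<mu>" and "x \<in> N \<longrightarrow> ennreal (?f x / partition_fun \<mu> ?f) = 0"
    then have "g x = 0 \<longrightarrow> ?f x = 0"
      using Z nn[OF x] by (auto simp: N_def ennreal_eq_0_iff divide_le_0_iff)
    then show "(g x / ?Z) *\<^sub>R ?w x = (exp (snd \<xi>) / ?Z) * ?f x"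
      by (cases "g x = 0") (auto simp: importance_weight_def field_simps)
  qed
  have int: "integrable \<mu> (\<lambda>x. (exp (snd \<xi>) / ?Z) * ?f x)"
    using f by (simp add: unnormalised_density_def)
  have gz: "AE x in \<mu>. 0 \<le> g x / ?Z" using nn Z by auto
  have "integrable \<mu> (\<lambda>x. (g x / ?Z) *\<^sub>R ?w x)"
    by (subst integrable_cong_AE[OF _ _ ae]) (use int in auto)
  then show ?A unfolding normalised_measure_def
    by (subst integrable_density) (use gz in auto)
  have "(\<integral>x. ?w x \<partial>normalised_measure \<mu> g) = (\<integral>x. (g x / ?Z) *\<^sub>R ?w x \<partial>\<mu>)"
    unfolding normalised_measure_def by (subst integral_density) (use gz in auto)
  also have "\<dots> = (\<integral>x. (exp (snd \<xi>) / ?Z) * ?f x \<partial>\<mu>)"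
    by (rule integral_cong_AE[OF _ _ ae]) auto
  finally show ?B by (simp add: partition_fun_def)
qed

section \<open>Semi-continuity\<close>

text \<open>Open neighbourhoods that include the point itself are more convenient than \<open>at t within S\<close>
  here: a product neighbourhood of \<open>(\<theta>, \<nu>)\<close> contains points \<open>(\<theta>, \<nu>')\<close> with the same first component,
  about which a filter punctured at \<open>\<theta>\<close> says nothing.\<close>

lemma lower_semicont_within_iff_open:
  assumes "t \<in> S"
  shows "lower_semicont_within f t S \<longleftrightarrow>
    (\<forall>c < f t. \<exists>U. open U \<and> t \<in> U \<and> (\<forall>s\<in>U \<inter> S. c < f s))"
  unfolding lower_semicont_within_def eventually_at_topological by (metis IntI IntE)

lemma upper_semicont_within_iff_open:
  assumes "t \<in> S"
  shows "upper_semicont_within f t S \<longleftrightarrow>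
    (\<forall>c > f t. \<exists>U. open U \<and> t \<in> U \<and> (\<forall>s\<in>U \<inter> S. f s < c))"
  unfolding upper_semicont_within_def eventually_at_topological by (metis IntI IntE)

lemma upper_semicont_within_uminus:
  "upper_semicont_within (\<lambda>s. - f s) t S \<longleftrightarrow> lower_semicont_within f t S"
proof
  assume *: "upper_semicont_within (\<lambda>s. - f s) t S"
  show "lower_semicont_within f t S"
    unfolding lower_semicont_within_def
    using *[unfolded upper_semicont_within_def, rule_format, of "- c" for c] by simp
next
  assume *: "lower_semicont_within f t S"
  show "upper_semicont_within (\<lambda>s. - f s) t S"
    unfolding upper_semicont_within_def
    using *[unfolded lower_semicont_within_def, rule_format, of "- c" for c]
    by (auto simp: minus_less_iff)
qed

lemma upper_semicont_within_scaled_exp: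
  fixes f :: "'a::topological_space \<Rightarrow> real" and b :: real
  assumes f: "upper_semicont_within f (fst \<xi>) T" and b: "0 \<le> b" and \<xi>: "fst \<xi> \<in> T"
  shows "upper_semicont_within (\<lambda>\<xi>. f (fst \<xi>) / b * exp (snd \<xi>)) \<xi> (T \<times> UNIV)"
proof (cases "b = 0")
  case True
  then show ?thesis by (simp add: upper_semicont_within_def)
next
  case False
  with b have b: "0 < b" by simp
  obtain t \<nu> where \<xi>_eq: "\<xi> = (t, \<nu>)" by fastforce
  have "\<xi> \<in> T \<times> UNIV" using \<xi> by (simp add: mem_Times_iff)
  show ?thesis unfolding upper_semicont_within_iff_open[OF \<open>\<xi> \<in> T \<times> UNIV\<close>]
  proof (intro allI impI)
    fix c assume "f (fst \<xi>) / b * exp (snd \<xi>) < c"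
    then have "f t < c * b * exp (- \<nu>)"
      using b by (simp add: \<xi>_eq exp_minus field_simps)
    \<comment> \<open>Solving for \<open>f\<close> moves the exponential to the side of the constant, so that no case
      distinction on the sign of \<open>f\<close> arises.\<close>
    then obtain r where r: "f t < r" "r < c * b * exp (- \<nu>)" using dense by blast
    obtain U where U: "open U" "t \<in> U" "\<forall>s\<in>U \<inter> T. f s < r"
      using f[unfolded upper_semicont_within_iff_open[OF \<xi>]] r(1) by (auto simp: \<xi>_eq)
    define V where "V = {\<nu>. r < c * b * exp (- \<nu>)}"
    have "open V" unfolding V_def by (intro open_Collect_less continuous_intros)
    moreover have "\<forall>s\<in>(U \<times> V) \<inter> (T \<times> UNIV). f (fst s) / b * exp (snd s) < c"
    proof
      fix s assume "s \<in> (U \<times> V) \<inter> (T \<times> UNIV)"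
      then have "f (fst s) < c * b * exp (- snd s)" using U(3) by (force simp: V_def)
      then show "f (fst s) / b * exp (snd s) < c" using b by (simp add: exp_minus field_simps)
    qed
    ultimately show "\<exists>U. open U \<and> \<xi> \<in> U \<and> (\<forall>s\<in>U \<inter> (T \<times> UNIV). f (fst s) / b * exp (snd s) < c)"
      using U(1,2) r(2) by (intro exI[of _ "U \<times> V"]) (auto simp: open_Times \<xi>_eq V_def)
  qed
qed

lemma lower_semicont_within_scaled_exp:
  fixes f :: "'a::topological_space \<Rightarrow> real" and b :: real
  assumes f: "lower_semicont_within f (fst \<xi>) T" and b: "0 \<le> b" and \<xi>: "fst \<xi> \<in> T"
  shows "lower_semicont_within (\<lambda>\<xi>. f (fst \<xi>) / b * exp (snd \<xi>)) \<xi> (T \<times> UNIV)"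
  using upper_semicont_within_scaled_exp[of "\<lambda>s. - f s" \<xi> T b] f b \<xi>
  by (simp add: upper_semicont_within_uminus flip: upper_semicont_within_uminus[of "\<lambda>\<xi>. f (fst \<xi>) / b * exp (snd \<xi>)"])

text \<open>All factors can be enlarged by a common \<open>\<delta>\<close> while keeping the product at \<open>p\<close> below \<open>c\<close>;
  each factor stays below its enlarged value near \<open>p\<close>. This remains valid if some factors vanish.\<close>

lemma prod_less_near:
  fixes V :: "'i \<Rightarrow> 'p::topological_space \<Rightarrow> real"
  assumes "finite I" "p \<in> S"
    and nonneg: "\<And>i s. i \<in> I \<Longrightarrow> s \<in> S \<Longrightarrow> 0 \<le> V i s"
    and usc: "\<And>i. i \<in> I \<Longrightarrow> upper_semicont_within (V i) p S"
    and less: "(\<Prod>i\<in>I. V i p) < c"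
  shows "\<exists>U. open U \<and> p \<in> U \<and> (\<forall>s\<in>U \<inter> S. (\<Prod>i\<in>I. V i s) < c)"
proof -
  have "((\<lambda>\<delta>. \<Prod>i\<in>I. V i p + \<delta>) \<longlongrightarrow> (\<Prod>i\<in>I. V i p + 0)) (at_right 0)"
    by (intro tendsto_intros)
  then have "\<forall>\<^sub>F \<delta> in at_right 0. (\<Prod>i\<in>I. V i p + \<delta>) < c"
    using less by (auto intro: order_tendstoD(2))
  moreover have "\<forall>\<^sub>F \<delta> in at_right 0. (0::real) < \<delta>" by (simp add: eventually_at_right_less)
  ultimately have "\<forall>\<^sub>F \<delta> in at_right 0. (\<Prod>i\<in>I. V i p + \<delta>) < c \<and> 0 < \<delta>"
    by (rule eventually_conj)
  then obtain \<delta> where \<delta>: "(\<Prod>i\<in>I. V i p + \<delta>) < c" "0 < \<delta>"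
    using eventually_happens'[OF trivial_limit_at_right_real] by blast
  have "\<forall>i\<in>I. \<exists>U. open U \<and> p \<in> U \<and> (\<forall>s\<in>U \<inter> S. V i s < V i p + \<delta>)"
    using usc[unfolded upper_semicont_within_iff_open[OF assms(2)]] \<delta>(2) by simp
  then obtain U where U: "\<And>i. i \<in> I \<Longrightarrow> open (U i) \<and> p \<in> U i \<and> (\<forall>s\<in>U i \<inter> S. V i s < V i p + \<delta>)"
    by metis
  have "(\<Prod>i\<in>I. V i s) < c" if "s \<in> (\<Inter>i\<in>I. U i) \<inter> S" for s
  proof -
    have "(\<Prod>i\<in>I. V i s) \<le> (\<Prod>i\<in>I. V i p + \<delta>)"
      using U that nonneg by (intro prod_mono) (auto simp: less_imp_le)
    then show ?thesis using \<delta>(1) by simp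
  qed
  then show ?thesis using U assms(1) by (intro exI[of _ "\<Inter>i\<in>I. U i"]) auto
qed

section \<open>Bounded local minorants\<close>

text \<open>
  The minorant is the infimum of \<open>W\<close> over \<open>p\<close> and the points of a countable dense set \<open>D\<close> in
  a small ball \<open>B\<close> around \<open>p\<close>, hence measurable. If \<open>W s x\<close> were below it for some \<open>s\<close> in \<open>B\<close>, upper
  semi-continuity at \<open>s\<close> would propagate this to a nearby point of \<open>D\<close>, which is absurd. Lower
  semi-continuity at \<open>p\<close> gives pointwise convergence to \<open>W p\<close> as the radius shrinks, and dominated
  convergence that of the expectations.

  The minorant is bounded because it will be inserted into \<open>ln (1 + u) \<ge> u - u\<^sup>2\<close>, where the squares
  must be negligible. It lies below \<open>W\<close> at every \<open>x\<close>, not just almost every \<open>x\<close>: the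
  distributions of the individual \<open>X\<^sub>j\<close> of an ergodic process may charge \<open>P\<close>-null sets.
\<close>

lemma ex_bounded_local_minorant:
  fixes W :: "'p::{metric_space, second_countable_topology} \<Rightarrow> 'x \<Rightarrow> real"
  assumes p: "p \<in> S"
    and meas: "\<And>s. s \<in> S \<Longrightarrow> W s \<in> borel_measurable P"
    and nonneg: "\<And>s x. s \<in> S \<Longrightarrow> x \<in> space P \<Longrightarrow> 0 \<le> W s x"
    and int: "integrable P (W p)"
    and lsc: "AE x in P. lower_semicont_within (\<lambda>s. W s x) p S"
    and usc: "AE x in P. \<forall>s\<in>S. upper_semicont_within (\<lambda>s. W s x) s S"
    and c: "c < (\<integral>x. W p x \<partial>P)"
  obtains U \<phi> C where "open U" "p \<in> U" "integrable P \<phi>" "c < (\<integral>x. \<phi> x \<partial>P)"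
    "\<And>x. x \<in> space P \<Longrightarrow> 0 \<le> \<phi> x \<and> \<phi> x \<le> C"
    "\<And>s x. s \<in> U \<inter> S \<Longrightarrow> x \<in> space P \<Longrightarrow> \<phi> x \<le> W s x"
proof -
  obtain D where D: "countable D" "D \<subseteq> S" "S \<subseteq> closure D" by (rule separable)
  define B where "B k = ball p (1 / real (Suc k))" for k
  define A where "A k = insert p (D \<inter> B k)" for k
  define f where "f k x = (INF s\<in>A k. W s x)" for k x
  have A: "A k \<subseteq> S" "p \<in> A k" "countable (A k)" for k
    using D p by (auto simp: A_def)
  have bdd: "bdd_below ((\<lambda>s. W s x) ` A k)" if "x \<in> space P" for x k
    using nonneg[OF subsetD[OF A(1)] that] by (intro bdd_belowI[of _ 0]) auto
  have f_le: "f k x \<le> W s x" if "s \<in> A k" "x \<in> space P" for s k x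
    unfolding f_def by (rule cINF_lower[OF bdd[OF that(2)] that(1)])
  have f_nonneg: "0 \<le> f k x" if "x \<in> space P" for k x
    unfolding f_def using A(2) nonneg[OF subsetD[OF A(1)] that] by (intro cINF_greatest) auto
  have f_meas[measurable]: "f k \<in> borel_measurable P" for k
    unfolding f_def using A(3) meas[OF subsetD[OF A(1)]] bdd by (intro borel_measurable_cINF) auto
  obtain N where N: "N \<in> null_sets P"
    and uscN: "\<And>x s. x \<in> space P - N \<Longrightarrow> s \<in> S \<Longrightarrow> upper_semicont_within (\<lambda>s. W s x) s S"
    using usc by (elim AE_E3) auto
  have [measurable]: "N \<in> sets P" using N by auto
  \<comment> \<open>The value 0 on the exceptional set and the truncation at \<open>k\<close>, which disappears in the
    limit, yield the bounds at every point.\<close>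
  define \<phi> where "\<phi> k x = (if x \<in> N then 0 else min (real k) (f k x))" for k x
  have \<phi>_bounds: "0 \<le> \<phi> k x" "\<phi> k x \<le> real k" "\<phi> k x \<le> W p x" if "x \<in> space P" for k x
    using f_nonneg[OF that, of k] f_le[OF A(2) that, of k] nonneg[OF p that]
    by (auto simp: \<phi>_def)
  have \<phi>_meas[measurable]: "\<phi> k \<in> borel_measurable P" for k
    unfolding \<phi>_def by measurable
  have minor: "\<phi> k x \<le> W s x" if s: "s \<in> B k \<inter> S" and x: "x \<in> space P" for k s x
  proof (cases "x \<in> N")
    case True
    then show ?thesis using nonneg s x by (simp add: \<phi>_def)
  next
    case False
    have "f k x \<le> W s x"
    proof (rule ccontr)
      assume "\<not> f k x \<le> W s x"
      then have less: "W s x < f k x" by simp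
      have "upper_semicont_within (\<lambda>s. W s x) s S" using uscN s x False by simp
      then have "\<forall>c > W s x. \<exists>O'. open O' \<and> s \<in> O' \<and> (\<forall>t\<in>O' \<inter> S. W t x < c)"
        by (rule upper_semicont_within_iff_open[OF IntD2[OF s], THEN iffD1])
      from this[rule_format, OF less]
      obtain O' where O: "open O'" "s \<in> O'" "\<forall>t\<in>O' \<inter> S. W t x < f k x"
        by (elim exE conjE)
      have "open (O' \<inter> B k)" "O' \<inter> B k \<inter> closure D \<noteq> {}" using s D(3) O by (auto simp: B_def)
      then have "O' \<inter> B k \<inter> D \<noteq> {}" using open_Int_closure_eq_empty by blast
      then obtain d where d: "d \<in> D" "d \<in> O'" "d \<in> B k" by blast
      then have "W d x < f k x" using O(3) D(2) by blast
      moreover have "f k x \<le> W d x" using d x by (intro f_le) (simp_all add: A_def)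
      ultimately show False by simp
    qed
    then show ?thesis using False by (simp add: \<phi>_def)
  qed
  have lim: "AE x in P. (\<lambda>k. \<phi> k x) \<longlonglongrightarrow> W p x"
    using lsc AE_not_in[OF N] AE_space
  proof eventually_elim
    case (elim x)
    show ?case
    proof (rule order_tendstoI)
      fix a assume "a < W p x"
      then obtain b where b: "a < b" "b < W p x" using dense by blast
      obtain V where V: "open V" "p \<in> V" "\<forall>s\<in>V \<inter> S. b < W s x"
        using elim(1) b(2) lower_semicont_within_iff_open[OF p, of "\<lambda>s. W s x"] by auto
      obtain r where r: "0 < r" "ball p r \<subseteq> V" using V(1,2) open_contains_ball by blast
      have "\<forall>\<^sub>F k in sequentially. 1 / real (Suc k) < r"
        by (rule order_tendstoD(2)[OF _ r(1)]) real_asymp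
      moreover have "\<forall>\<^sub>F k in sequentially. b < real k" by real_asymp
      ultimately show "\<forall>\<^sub>F k in sequentially. a < \<phi> k x"
      proof eventually_elim
        case (elim k)
        have "b \<le> W s x" if "s \<in> A k" for s
        proof -
          have "s \<in> ball p r" using that elim(1) r(1) by (auto simp: A_def B_def)
          then show ?thesis using V(3) r(2) A(1) that by force
        qed
        then have "b \<le> f k x" unfolding f_def using A(2) by (intro cINF_greatest) auto
        then show ?case using elim(2) b(1) \<open>x \<notin> N\<close> by (simp add: \<phi>_def)
      qed
    next
      fix a assume "W p x < a"
      then show "\<forall>\<^sub>F k in sequentially. \<phi> k x < a"
        using le_less_trans[OF \<phi>_bounds(3)[OF \<open>x \<in> space P\<close>]] by simp
    qed
  qed
  have "(\<lambda>k. \<integral>x. \<phi> k x \<partial>P) \<longlonglongrightarrow> (\<integral>x. W p x \<partial>P)"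
    using \<phi>_bounds
    by (intro integral_dominated_convergence[where w = "W p"] int lim) (auto intro!: AE_I2 meas p)
  then obtain k where "c < (\<integral>x. \<phi> k x \<partial>P)"
    using order_tendstoD(1)[OF _ c] by (metis eventually_happens' sequentially_bot)
  moreover have "integrable P (\<phi> k)"
    using \<phi>_bounds nonneg[OF p] by (intro Bochner_Integration.integrable_bound[OF int]) (auto intro!: AE_I2)
  ultimately show ?thesis using that[of "B k" "\<phi> k" "real k"] minor \<phi>_bounds by (simp add: B_def)
qed

section \<open>Asymptotics of the likelihood\<close>

lemma prod_inverse_one_plus_ge:
  fixes u :: "'i \<Rightarrow> real"
  assumes "\<And>j. j \<in> J \<Longrightarrow> 0 \<le> u j"
  shows "exp (- (\<Sum>j\<in>J. u j)) \<le> (\<Prod>j\<in>J. 1 / (1 + u j))"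
proof (cases "finite J")
  case True
  have "exp (- u j) \<le> 1 / (1 + u j)" if "j \<in> J" for j
    using assms[OF that] exp_ge_add_one_self[of "u j"] by (simp add: exp_minus field_simps)
  then show ?thesis using True by (simp add: exp_sum prod_mono flip: sum_negf)
qed simp

text \<open>This is \<open>ln (1 + u) \<ge> u - u\<^sup>2\<close>, summed. With \<open>u = (n/m) \<phi>\<close> and \<open>\<phi>\<close> bounded by a constant, the error
  \<open>card J \<cdot> C\<^sup>2\<close> is of order \<open>m \<cdot> (n/m)\<^sup>2\<close> and vanishes as \<open>m \<rightarrow> \<infinity>\<close>.\<close>

lemma prod_inverse_one_plus_le:
  fixes u v :: "'i \<Rightarrow> real"
  assumes u: "\<And>j. j \<in> J \<Longrightarrow> 0 \<le> u j \<and> u j \<le> v j \<and> u j \<le> C"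
  shows "(\<Prod>j\<in>J. 1 / (1 + v j)) \<le> exp (real (card J) * C\<^sup>2 - (\<Sum>j\<in>J. u j))"
proof (cases "finite J")
  case True
  have "1 / (1 + v j) \<le> exp (C\<^sup>2 - u j)" if "j \<in> J" for j
  proof -
    have uj: "0 \<le> u j" "u j \<le> v j" "u j \<le> C" using u that by auto
    have "u j - (u j)\<^sup>2 \<le> ln (1 + u j)"
    proof (cases "u j \<le> 1")
      case False
      then have "u j - (u j)\<^sup>2 \<le> 0" by (simp add: power2_eq_square)
      also have "0 \<le> ln (1 + u j)" using uj by simp
      finally show ?thesis .
    qed (use uj ln_one_plus_pos_lower_bound in auto)
    moreover have "(u j)\<^sup>2 \<le> C\<^sup>2" using uj by (simp add: power_mono)
    ultimately have "- ln (1 + u j) \<le> C\<^sup>2 - u j" by simp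
    then have "exp (- ln (1 + u j)) \<le> exp (C\<^sup>2 - u j)" by simp
    moreover have "exp (- ln (1 + u j)) = 1 / (1 + u j)" using uj by (simp add: exp_minus field_simps)
    moreover have "1 / (1 + v j) \<le> 1 / (1 + u j)" using uj by (intro divide_left_mono) auto
    ultimately show ?thesis by linarith
  qed
  moreover have "0 \<le> v j" if "j \<in> J" for j using u[OF that] by linarith
  ultimately have "(\<Prod>j\<in>J. 1 / (1 + v j)) \<le> (\<Prod>j\<in>J. exp (C\<^sup>2 - u j))"
    by (intro prod_mono) auto
  also have "\<dots> = exp (real (card J) * C\<^sup>2 - (\<Sum>j\<in>J. u j))"
    using True by (simp add: sum_subtractf flip: exp_sum)
  finally show ?thesis .
qed simp

text \<open>Since \<open>1 / (1 + u) \<ge> exp (- u)\<close>, convergence of the means bounds the criterion from below by a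
  sequence tending to its limit. The factor \<open>exp (- \<epsilon> m)\<close> is the tolerance allowed to an approximate
  maximiser.\<close>

lemma nce_lik_eventually_greater:
  assumes wy: "\<And>i. i \<in> {1..n} \<Longrightarrow> 0 \<le> w (y i)" and wx: "\<And>j. 1 \<le> j \<Longrightarrow> 0 \<le> w (x j)"
    and mean: "(\<lambda>m. (1 / real m) * (\<Sum>j=1..m. w (x j))) \<longlonglongrightarrow> (\<integral>x. w x \<partial>P)"
    and \<epsilon>: "\<epsilon> \<longlonglongrightarrow> 0"
    and c: "c < poisson_lik n y P w"
  shows "\<forall>\<^sub>F m in sequentially. c < nce_lik n m y x w * exp (- \<epsilon> m)"
proof -
  define l where "l m = (\<Prod>i=1..n. w (y i) / (1 + real n / real m * w (y i))) *
    exp (- (real n * ((1 / real m) * (\<Sum>j=1..m. w (x j))))) * exp (- \<epsilon> m)" for m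
  have "(\<lambda>m. real n / real m) \<longlonglongrightarrow> 0" by real_asymp
  then have "l \<longlonglongrightarrow> (\<Prod>i=1..n. w (y i) / (1 + 0 * w (y i))) * exp (- (real n * (\<integral>x. w x \<partial>P))) * exp (- 0)"
    unfolding l_def by (intro tendsto_intros mean \<epsilon>) auto
  then have "l \<longlonglongrightarrow> poisson_lik n y P w" by (simp add: poisson_lik_def)
  then have "\<forall>\<^sub>F m in sequentially. c < l m" using c by (rule order_tendstoD)
  then show ?thesis
  proof eventually_elim
    case (elim m)
    have "exp (- (\<Sum>j=1..m. real n / real m * w (x j))) \<le> (\<Prod>j=1..m. 1 / (1 + real n / real m * w (x j)))"
      using wx by (intro prod_inverse_one_plus_ge) auto
    then have "l m \<le> nce_lik n m y x w * exp (- \<epsilon> m)"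
      unfolding l_def nce_lik_def using wy
      by (intro mult_right_mono mult_left_mono prod_nonneg) (auto simp: sum_distrib_left)
    with elim show ?case by simp
  qed
qed

text \<open>On a small neighbourhood the observed part is controlled by upper semi-continuity at the \<open>y\<^sub>i\<close>.
  In the simulated part all \<open>W s\<close> are replaced by one integrable minorant \<open>\<phi>\<close>, so that a single
  application of ergodicity, to \<open>\<phi>\<close>, gives a bound that is uniform in \<open>s\<close>.\<close>

lemma nce_lik_less_near:
  fixes W :: "'p::{metric_space, second_countable_topology} \<Rightarrow> 'x \<Rightarrow> real"
  assumes erg: "ergodic_process M P X" and p: "p \<in> S" and n: "0 < n"
    and nonneg: "\<And>s x. s \<in> S \<Longrightarrow> x \<in> space P \<Longrightarrow> 0 \<le> W s x"
    and y: "\<And>i. i \<in> {1..n} \<Longrightarrow> y i \<in> space P"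
    and int: "\<And>s. s \<in> S \<Longrightarrow> integrable P (W s)"
    and lsc: "AE x in P. lower_semicont_within (\<lambda>s. W s x) p S"
    and usc: "AE x in P. \<forall>s\<in>S. upper_semicont_within (\<lambda>s. W s x) s S"
    and usc_y: "\<And>i. i \<in> {1..n} \<Longrightarrow> upper_semicont_within (\<lambda>s. W s (y i)) p S"
    and c: "poisson_lik n y P (W p) < c"
  obtains U where "open U" "p \<in> U"
    "AE \<omega> in M. \<forall>\<^sub>F m in sequentially. \<forall>s\<in>U \<inter> S. nce_lik n m y (\<lambda>j. X j \<omega>) (W s) < c"
proof -
  define I where "I = (\<integral>x. W p x \<partial>P)"
  define Y where "Y s = (\<Prod>i=1..n. W s (y i))" for s
  have Y_nonneg: "0 \<le> Y s" if "s \<in> S" for s using that y nonneg by (auto simp: Y_def intro!: prod_nonneg)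
  have "((\<lambda>\<delta>. (Y p + \<delta>) * exp (- (real n * (I - \<delta>)))) \<longlongrightarrow> (Y p + 0) * exp (- (real n * (I - 0)))) (at_right 0)"
    by (intro tendsto_intros)
  then have "\<forall>\<^sub>F \<delta> in at_right 0. (Y p + \<delta>) * exp (- (real n * (I - \<delta>))) < c"
    using c by (intro order_tendstoD(2)) (auto simp: Y_def I_def poisson_lik_def)
  moreover have "\<forall>\<^sub>F \<delta> in at_right 0. (0::real) < \<delta>" by (simp add: eventually_at_right_less)
  ultimately have "\<forall>\<^sub>F \<delta> in at_right 0. (Y p + \<delta>) * exp (- (real n * (I - \<delta>))) < c \<and> 0 < \<delta>"
    by (rule eventually_conj)
  then obtain \<delta> where \<delta>: "(Y p + \<delta>) * exp (- (real n * (I - \<delta>))) < c" "0 < \<delta>"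
    using eventually_happens'[OF trivial_limit_at_right_real] by blast
  \<comment> \<open>The slack \<open>\<delta>\<close> is spent both on the observed part and on the expectation of the minorant.\<close>
  define a where "a = Y p + \<delta>"
  have a: "0 < a" using \<delta> Y_nonneg[OF p] by (simp add: a_def)
  obtain U1 where U1: "open U1" "p \<in> U1" "\<forall>s\<in>U1 \<inter> S. Y s < a"
    using prod_less_near[of "{1..n}" p S "\<lambda>i s. W s (y i)" a] p nonneg y usc_y \<delta>(2)
    by (auto simp: Y_def a_def)
  have "I - \<delta> < (\<integral>x. W p x \<partial>P)" using \<delta>(2) by (simp add: I_def)
  from ex_bounded_local_minorant[of p S W P, OF p _ nonneg int[OF p] lsc usc this] int
  obtain U2 \<phi> C where U2: "open U2" "p \<in> U2" and \<phi>: "integrable P \<phi>" "I - \<delta> < (\<integral>x. \<phi> x \<partial>P)"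
    "\<And>x. x \<in> space P \<Longrightarrow> 0 \<le> \<phi> x \<and> \<phi> x \<le> C"
    "\<And>s x. s \<in> U2 \<inter> S \<Longrightarrow> x \<in> space P \<Longrightarrow> \<phi> x \<le> W s x"
    by (metis borel_measurable_integrable)
  define J where "J = (\<integral>x. \<phi> x \<partial>P)"
  have lim_less: "a * exp (- (real n * J)) < c"
  proof -
    have "a * exp (- (real n * J)) \<le> a * exp (- (real n * (I - \<delta>)))"
      using a \<phi>(2) by (simp add: J_def mult_left_mono)
    then show ?thesis using \<delta>(1) by (simp add: a_def)
  qed
  have "AE \<omega> in M. (\<lambda>m. (1 / real m) * (\<Sum>j=1..m. \<phi> (X j \<omega>))) \<longlonglongrightarrow> J"
    using erg \<phi>(1) by (auto simp: ergodic_process_def J_def)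
  then have "AE \<omega> in M. \<forall>\<^sub>F m in sequentially. \<forall>s\<in>U1 \<inter> U2 \<inter> S. nce_lik n m y (\<lambda>j. X j \<omega>) (W s) < c"
  proof (rule AE_mp, intro AE_I2 impI)
    fix \<omega> assume \<omega>: "\<omega> \<in> space M" and
      mean: "(\<lambda>m. (1 / real m) * (\<Sum>j=1..m. \<phi> (X j \<omega>))) \<longlonglongrightarrow> J"
    have X: "X j \<omega> \<in> space P" if "1 \<le> j" for j
      using erg that \<omega> by (auto simp: ergodic_process_def dest: measurable_space)
    define b where "b m = a * exp ((real n * C)\<^sup>2 * (1 / real m) -
      real n * ((1 / real m) * (\<Sum>j=1..m. \<phi> (X j \<omega>))))" for m
    have "(\<lambda>m. 1 / real m) \<longlonglongrightarrow> 0" by real_asymp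
    then have "b \<longlonglongrightarrow> a * exp ((real n * C)\<^sup>2 * 0 - real n * J)"
      unfolding b_def by (intro tendsto_intros mean)
    then have "\<forall>\<^sub>F m in sequentially. b m < c"
      using lim_less by (intro order_tendstoD(2)) auto
    then show "\<forall>\<^sub>F m in sequentially. \<forall>s\<in>U1 \<inter> U2 \<inter> S. nce_lik n m y (\<lambda>j. X j \<omega>) (W s) < c"
      using eventually_gt_at_top[of 0]
    proof eventually_elim
      case (elim m)
      show ?case
      proof
        fix s assume s: "s \<in> U1 \<inter> U2 \<inter> S"
        define r where "r = real n / real m"
        have r: "0 < r" using n elim by (simp add: r_def)
        have "(\<Prod>i=1..n. W s (y i) / (1 + r * W s (y i))) \<le> Y s"
          unfolding Y_def
        proof (intro prod_mono conjI)
          fix i assume "i \<in> {1..n}"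
          then have u: "0 \<le> W s (y i)" "0 \<le> r * W s (y i)" using s nonneg y r by auto
          show "0 \<le> W s (y i) / (1 + r * W s (y i))" using u by simp
          have "W s (y i) / (1 + r * W s (y i)) \<le> W s (y i) / 1"
            using u by (intro divide_left_mono) auto
          then show "W s (y i) / (1 + r * W s (y i)) \<le> W s (y i)" by simp
        qed
        also have "Y s \<le> a" using U1 s by force
        finally have 1: "(\<Prod>i=1..n. W s (y i) / (1 + r * W s (y i))) \<le> a" .
        have "(\<Prod>j=1..m. 1 / (1 + r * W s (X j \<omega>))) \<le>
            exp (real (card {1..m}) * (r * C)\<^sup>2 - (\<Sum>j=1..m. r * \<phi> (X j \<omega>)))"
          using r s X \<phi>(3,4) by (intro prod_inverse_one_plus_le) (auto intro!: mult_left_mono)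
        also have "real (card {1..m}) * (r * C)\<^sup>2 - (\<Sum>j=1..m. r * \<phi> (X j \<omega>)) =
            (real n * C)\<^sup>2 * (1 / real m) - real n * ((1 / real m) * (\<Sum>j=1..m. \<phi> (X j \<omega>)))"
          using elim by (subst sum_distrib_left[symmetric]) (simp add: r_def power2_eq_square)
        finally have 2: "(\<Prod>j=1..m. 1 / (1 + r * W s (X j \<omega>))) \<le>
            exp ((real n * C)\<^sup>2 * (1 / real m) - real n * ((1 / real m) * (\<Sum>j=1..m. \<phi> (X j \<omega>))))" .
        have "nce_lik n m y (\<lambda>j. X j \<omega>) (W s) \<le> b m"
          unfolding nce_lik_def b_def r_def[symmetric] using 1 2 a r s nonneg X
          by (intro mult_mono prod_nonneg) auto
        then show "nce_lik n m y (\<lambda>j. X j \<omega>) (W s) < c" using elim by simp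
      qed
    qed
  qed
  then show ?thesis using that[of "U1 \<inter> U2"] U1 U2 by auto
qed

section \<open>Consistency\<close>

lemma tendsto_of_local_separation:
  fixes a :: "'p::topological_space"
  assumes K: "compact K" "\<And>m. 1 \<le> m \<Longrightarrow> z m \<in> K"
    and cover: "K - {a} \<subseteq> \<Union>\<U>" "\<And>U. U \<in> \<U> \<Longrightarrow> open U"
    and leave: "\<And>U. U \<in> \<U> \<Longrightarrow> \<forall>\<^sub>F m in sequentially. z m \<notin> U"
  shows "z \<longlonglongrightarrow> a"
proof (rule topological_tendstoI)
  fix V assume V: "open V" "a \<in> V"
  have "compact (K - V)" using K(1) V(1) by (rule compact_diff)
  moreover have "K - V \<subseteq> \<Union>\<U>" using cover(1) V(2) by auto
  ultimately obtain \<F> where \<F>: "\<F> \<subseteq> \<U>" "finite \<F>" "K - V \<subseteq> \<Union>\<F>"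
    using cover(2) by (meson compactE)
  have "\<forall>\<^sub>F m in sequentially. \<forall>U\<in>\<F>. z m \<notin> U"
    using \<F> leave by (intro eventually_ball_finite) auto
  then show "\<forall>\<^sub>F m in sequentially. z m \<in> V"
    using eventually_ge_at_top[of 1]
  proof eventually_elim
    case (elim m)
    then show ?case using K(2)[of m] \<F>(3) by auto
  qed
qed

theorem theorem1:
  fixes \<Theta> :: "(real ^ 'd) set"
    and Xs :: "(real ^ 'k) set"
    and \<mu> :: "(real ^ 'k) measure"
    and h :: "real ^ 'd \<Rightarrow> real ^ 'k \<Rightarrow> real"
    and h\<psi> :: "real ^ 'k \<Rightarrow> real"
    and n :: nat
    and y :: "nat \<Rightarrow> real ^ 'k"
    and M :: "'w measure"
    and X :: "nat \<Rightarrow> 'w \<Rightarrow> real ^ 'k"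
    and \<xi>_nce :: "nat \<Rightarrow> 'w \<Rightarrow> (real ^ 'd) \<times> real"
    and \<xi>_mle :: "(real ^ 'd) \<times> real"
  defines "P\<psi> \<equiv> normalised_measure \<mu> h\<psi>"
    and "\<Xi> \<equiv> \<Theta> \<times> (UNIV :: real set)"
  assumes open_Theta: "open \<Theta>"
    and sets_mu: "sets \<mu> = sets (restrict_space borel Xs)"
    and model: "\<And>\<theta>. \<theta> \<in> \<Theta> \<Longrightarrow> unnormalised_density \<mu> (h \<theta>)"
    and identifiable: "inj_on (\<lambda>\<theta>. normalised_measure \<mu> (h \<theta>)) \<Theta>"
    and reference: "unnormalised_density \<mu> h\<psi>"
    and dominated: "\<And>\<theta>. \<theta> \<in> \<Theta> \<Longrightarrow> absolutely_continuous P\<psi> (normalised_measure \<mu> (h \<theta>))"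
    and n_pos: "1 \<le> n"
    and obs: "\<And>i. i \<in> {1..n} \<Longrightarrow> y i \<in> Xs \<and> 0 < h\<psi> (y i)"
    and MLE: "unique_maximiser (ext_log_lik n y \<mu> h h\<psi>) \<Xi> \<xi>_mle"
    and prob: "prob_space M"
    and X1: "ergodic_process M P\<psi> X"
    and C1_random: "\<And>m. 1 \<le> m \<Longrightarrow> \<xi>_nce m \<in> borel_measurable M"
    and C1_approx: "AE \<omega> in M. \<exists>\<epsilon> :: nat \<Rightarrow> real. \<epsilon> \<longlonglongrightarrow> 0 \<and>
          (\<forall>\<^sub>F m in sequentially.
             nce_objective n m y (\<lambda>j. X j \<omega>) h h\<psi> (\<xi>_nce m \<omega>)
               \<ge> (SUP \<xi>\<in>\<Xi>. nce_objective n m y (\<lambda>j. X j \<omega>) h h\<psi> \<xi>) - ereal (\<epsilon> m))"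
    and C1_compact: "AE \<omega> in M. \<exists>K. compact K \<and> K \<subseteq> \<Xi> \<and> (\<forall>m\<ge>1. \<xi>_nce m \<omega> \<in> K)"
    and H1_lower: "\<And>\<theta>. \<theta> \<in> \<Theta> \<Longrightarrow>
          AE x in P\<psi>. lower_semicont_within (\<lambda>t. h t x) \<theta> \<Theta>"
    and H1_upper: "AE x in P\<psi>. \<forall>\<theta>\<in>\<Theta>. upper_semicont_within (\<lambda>t. h t x) \<theta> \<Theta>"
    and H1_upper_obs: "\<And>i. i \<in> {1..n} \<Longrightarrow>
          \<forall>\<theta>\<in>\<Theta>. upper_semicont_within (\<lambda>t. h t (y i)) \<theta> \<Theta>"
  shows "AE \<omega> in M. (\<lambda>m. \<xi>_nce m \<omega>) \<longlonglongrightarrow> \<xi>_mle"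
proof -
  let ?W = "importance_weight h h\<psi>"
  let ?G = "\<lambda>\<xi>. poisson_lik n y P\<psi> (?W \<xi>)"
  have n: "0 < n" using n_pos by simp
  have space_mu: "space \<mu> = Xs"
    using sets_eq_imp_space_eq[OF sets_mu] by (simp add: space_restrict_space)
  have space_P: "space P\<psi> = Xs" by (simp add: P\<psi>_def normalised_measure_def space_mu)
  have g_nonneg: "0 \<le> h\<psi> x" if "x \<in> Xs" for x
    using reference that by (simp add: unnormalised_density_def space_mu)
  have h_nonneg: "0 \<le> h (fst \<xi>) x" if "\<xi> \<in> \<Xi>" "x \<in> Xs" for \<xi> x
    using model[of "fst \<xi>"] that by (auto simp: unnormalised_density_def space_mu \<Xi>_def)
  have W_nonneg: "0 \<le> ?W \<xi> x" if "\<xi> \<in> \<Xi>" "x \<in> Xs" for \<xi> x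
    using h_nonneg[OF that] g_nonneg[OF that(2)] by (simp add: importance_weight_def)
  have W: "integrable P\<psi> (?W \<xi>)"
    "(\<integral>x. ?W \<xi> x \<partial>P\<psi>) = exp (snd \<xi>) * (partition_fun \<mu> (h (fst \<xi>)) / partition_fun \<mu> h\<psi>)"
    if "\<xi> \<in> \<Xi>" for \<xi>
    using importance_weight_integral[of \<mu> h \<xi> h\<psi>] that model reference dominated
    by (auto simp: P\<psi>_def \<Xi>_def)
  have lsc: "AE x in P\<psi>. lower_semicont_within (\<lambda>\<xi>. ?W \<xi> x) \<xi> \<Xi>" if "\<xi> \<in> \<Xi>" for \<xi>
  proof -
    have \<xi>: "fst \<xi> \<in> \<Theta>" using that by (auto simp: \<Xi>_def)
    show ?thesis using H1_lower[OF \<xi>]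
      unfolding importance_weight_def \<Xi>_def
      by (rule AE_mp) (intro AE_I2 impI lower_semicont_within_scaled_exp g_nonneg \<xi>; simp add: space_P)
  qed
  have usc_at: "upper_semicont_within (\<lambda>\<xi>. ?W \<xi> x) \<xi> \<Xi>"
    if "\<forall>\<theta>\<in>\<Theta>. upper_semicont_within (\<lambda>t. h t x) \<theta> \<Theta>" "x \<in> Xs" "\<xi> \<in> \<Xi>" for x \<xi>
    using that unfolding importance_weight_def \<Xi>_def
    by (intro upper_semicont_within_scaled_exp) (auto intro: g_nonneg)
  have usc: "AE x in P\<psi>. \<forall>\<xi>\<in>\<Xi>. upper_semicont_within (\<lambda>\<xi>. ?W \<xi> x) \<xi> \<Xi>"
    using H1_upper by (rule AE_mp) (auto intro!: AE_I2 usc_at simp: space_P)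

  have ell: "ext_log_lik n y \<mu> h h\<psi> \<xi> = ereal (1 / real n) * elog (?G \<xi>)" if "\<xi> \<in> \<Xi>" for \<xi>
    using ext_log_lik_eq_elog_poisson_lik[OF n _ W(2)[OF that]] h_nonneg[OF that] g_nonneg obs by blast
  have G_nonneg: "0 \<le> ?G \<xi>" if "\<xi> \<in> \<Xi>" for \<xi>
    using W_nonneg[OF that] obs by (intro poisson_lik_nonneg) auto
  have mle: "\<xi>_mle \<in> \<Xi>"
    using MLE by (simp add: unique_maximiser_def is_arg_max_def)
  have G_less: "?G \<xi> < ?G \<xi>_mle" if "\<xi> \<in> \<Xi>" "\<xi> \<noteq> \<xi>_mle" for \<xi>
  proof (rule ccontr)
    assume "\<not> ?thesis"
    then have "elog (?G \<xi>_mle) \<le> elog (?G \<xi>)"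
      using G_nonneg that mle by (simp add: elog_le_iff)
    then have "ext_log_lik n y \<mu> h h\<psi> \<xi>_mle \<le> ext_log_lik n y \<mu> h h\<psi> \<xi>"
      unfolding ell[OF mle] ell[OF that(1)] by (intro ereal_mult_left_mono) auto
    then show False using unique_maximiser_less[OF MLE that] by (simp add: not_le[symmetric])
  qed

  \<comment> \<open>A constant strictly below the limit at the MLE is what keeps near-maximisers out of \<open>U\<close>. The
    exceptional event depends on \<open>U\<close>, hence the passage to a countable subcover.\<close>
  define \<U> where "\<U> = {U. open U \<and> (\<exists>c < ?G \<xi>_mle. AE \<omega> in M. \<forall>\<^sub>F m in sequentially.
    \<forall>\<xi>\<in>U \<inter> \<Xi>. nce_lik n m y (\<lambda>j. X j \<omega>) (?W \<xi>) < c)}"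
  have "\<Xi> - {\<xi>_mle} \<subseteq> \<Union>\<U>"
  proof
    fix \<xi> assume \<xi>: "\<xi> \<in> \<Xi> - {\<xi>_mle}"
    then obtain c where c: "?G \<xi> < c" "c < ?G \<xi>_mle" using G_less dense by blast
    obtain U where "open U" "\<xi> \<in> U" "AE \<omega> in M. \<forall>\<^sub>F m in sequentially.
        \<forall>\<xi>\<in>U \<inter> \<Xi>. nce_lik n m y (\<lambda>j. X j \<omega>) (?W \<xi>) < c"
      using \<xi> n obs W_nonneg W(1) lsc usc H1_upper_obs usc_at c(1)
      by (elim nce_lik_less_near[OF X1, of \<xi> \<Xi> n ?W y c, rotated -1]) (auto simp: space_P)
    then show "\<xi> \<in> \<Union>\<U>" using c(2) by (auto simp: \<U>_def)
  qed
  moreover obtain \<V> where \<V>: "\<V> \<subseteq> \<U>" "countable \<V>" "\<Union>\<V> = \<Union>\<U>"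
    by (rule Lindelof[of \<U>]) (auto simp: \<U>_def)
  ultimately have cover: "\<Xi> - {\<xi>_mle} \<subseteq> \<Union>\<V>" by simp
  have "AE \<omega> in M. \<forall>U\<in>\<V>. \<exists>c < ?G \<xi>_mle. \<forall>\<^sub>F m in sequentially.
      \<forall>\<xi>\<in>U \<inter> \<Xi>. nce_lik n m y (\<lambda>j. X j \<omega>) (?W \<xi>) < c"
    unfolding AE_ball_countable[OF \<V>(2)]
  proof
    fix U assume "U \<in> \<V>"
    then obtain c where "c < ?G \<xi>_mle" "AE \<omega> in M. \<forall>\<^sub>F m in sequentially.
        \<forall>\<xi>\<in>U \<inter> \<Xi>. nce_lik n m y (\<lambda>j. X j \<omega>) (?W \<xi>) < c" using \<V>(1) by (auto simp: \<U>_def)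
    then show "AE \<omega> in M. \<exists>c < ?G \<xi>_mle. \<forall>\<^sub>F m in sequentially.
        \<forall>\<xi>\<in>U \<inter> \<Xi>. nce_lik n m y (\<lambda>j. X j \<omega>) (?W \<xi>) < c" by (auto elim: AE_mp)
  qed
  moreover have "AE \<omega> in M. (\<lambda>m. (1 / real m) * (\<Sum>j=1..m. ?W \<xi>_mle (X j \<omega>)))
      \<longlonglongrightarrow> (\<integral>x. ?W \<xi>_mle x \<partial>P\<psi>)"
    using X1 W(1)[OF mle] by (auto simp: ergodic_process_def)
  ultimately show ?thesis
    using C1_approx C1_compact AE_space
  proof eventually_elim
    case (elim \<omega>)
    let ?F = "\<lambda>m \<xi>. nce_lik n m y (\<lambda>j. X j \<omega>) (?W \<xi>)"
    obtain \<epsilon> where \<epsilon>: "\<epsilon> \<longlonglongrightarrow> 0" "\<forall>\<^sub>F m in sequentially.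
        (SUP \<xi>\<in>\<Xi>. nce_objective n m y (\<lambda>j. X j \<omega>) h h\<psi> \<xi>) - ereal (\<epsilon> m)
          \<le> nce_objective n m y (\<lambda>j. X j \<omega>) h h\<psi> (\<xi>_nce m \<omega>)"
      using elim(3) by blast
    obtain K where K: "compact K" "K \<subseteq> \<Xi>" "\<And>m. 1 \<le> m \<Longrightarrow> \<xi>_nce m \<omega> \<in> K" using elim(4) by blast
    have X: "X j \<omega> \<in> Xs" if "1 \<le> j" for j
      using X1 that elim(5) measurable_space[of "X j" M P\<psi> \<omega>]
      by (auto simp: ergodic_process_def space_P)
    have F_nonneg: "0 \<le> ?F m \<xi>" if "\<xi> \<in> \<Xi>" for m \<xi>
      using W_nonneg[OF that] obs X by (intro nce_lik_nonneg) auto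
    have obj: "nce_objective n m y (\<lambda>j. X j \<omega>) h h\<psi> \<xi> = elog ((real n / real m) ^ n * ?F m \<xi>)"
      if "\<xi> \<in> \<Xi>" "0 < m" for m \<xi>
      using that h_nonneg g_nonneg obs X n by (intro nce_objective_eq_elog_nce_lik) auto
    have near_max: "\<forall>\<^sub>F m in sequentially. ?F m \<xi>_mle * exp (- \<epsilon> m) \<le> ?F m (\<xi>_nce m \<omega>)"
      using \<epsilon>(2) eventually_gt_at_top[of 0]
    proof eventually_elim
      case (elim m)
      define k where "k = (real n / real m) ^ n"
      have k: "0 < k" using n elim by (simp add: k_def)
      have nce: "\<xi>_nce m \<omega> \<in> \<Xi>" using K elim by (metis Suc_leI One_nat_def subsetD)
      have "elog (k * ?F m \<xi>_mle * exp (- \<epsilon> m)) = elog (k * ?F m \<xi>_mle) - ereal (\<epsilon> m)"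
        by (simp add: elog_mult_exp minus_ereal_def)
      also have "\<dots> \<le> (SUP \<xi>\<in>\<Xi>. nce_objective n m y (\<lambda>j. X j \<omega>) h h\<psi> \<xi>) - ereal (\<epsilon> m)"
        using mle elim by (intro ereal_minus_mono SUP_upper2[OF mle]) (auto simp: obj k_def)
      also have "\<dots> \<le> elog (k * ?F m (\<xi>_nce m \<omega>))"
        using elim obj[OF nce] by (simp add: k_def)
      finally have "k * ?F m \<xi>_mle * exp (- \<epsilon> m) \<le> k * ?F m (\<xi>_nce m \<omega>)"
        using k F_nonneg[OF mle] F_nonneg[OF nce] by (subst (asm) elog_le_iff) auto
      then show ?case using k by (simp add: mult.assoc)
    qed
    show ?case
    proof (rule tendsto_of_local_separation[OF K(1,3)])
      show "K - {\<xi>_mle} \<subseteq> \<Union>\<V>" using K(2) cover by auto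
      show "open U" if "U \<in> \<V>" for U using that \<V>(1) by (auto simp: \<U>_def)
      fix U assume "U \<in> \<V>"
      then obtain c where c: "c < ?G \<xi>_mle"
        and low: "\<forall>\<^sub>F m in sequentially. \<forall>\<xi>\<in>U \<inter> \<Xi>. ?F m \<xi> < c" using elim(1) by blast
      have "\<forall>\<^sub>F m in sequentially. c < ?F m \<xi>_mle * exp (- \<epsilon> m)"
        using W_nonneg[OF mle] obs X elim(2) \<epsilon>(1) c by (intro nce_lik_eventually_greater) auto
      with near_max low show "\<forall>\<^sub>F m in sequentially. \<xi>_nce m \<omega> \<notin> U"
        using eventually_ge_at_top[of 1]
      proof eventually_elim
        case (elim m)
        then show ?case using K(2) K(3)[of m] by force
      qed
    qed
  qed
qed

end
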